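(* Let $H, S\in\mathbb{C}^{n\times n}$ with $H$ Hermitian positive definite and $S^*=-S$, let $\sigma\in\mathbb{R}$, $A = \sigma H+S$, $B = iS$, and let $b, x_0\in\mathbb{C}^n$. Let $v_k, z_k$ ($k=1,\ldots,m+1$) and $T_{m+1,m}$ be produced by $m\ge 1$ steps of the flexible Lanczos process (described in the context) for $i\sigma H+B$ started with $r_0 = ib-(i\sigma H+B)x_0$, where it is assumed that the process does not break down. Let $V_{m+1} = [v_1,\ldots,v_{m+1}]$, let $x_m$ be the FMR iterate, and let $$\varrho_m := \min_{\zeta\in\mathbb{C}^m} \|\beta_0 e_1 - T_{m+1,m}\zeta\|_2 .$$ Then $$\|b-Ax_m\|_{H^{-1}} \le \|V_{m+1}\|_{H^{-1}}\cdot \varrho_m .$$ Moreover, if for some $\varepsilon\in[0,1)$ the vectors $z_k$ satisfy $$\|z_k - H^{-1}v_k\|_H \le \varepsilon\cdot \|H^{-1}v_k\|_H \quad\text{for } k=1,\ldots,m+1,$$ then $$\|V_{m+1}\|_{H^{-1}} \le \left(\frac{m+1}{1-\varepsilon}\right)^{1/2}.$$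
   Context: $\langle x,y\rangle = y^*x$ is the standard inner product on $\mathbb{C}^n$; $\|x\|_H = (x^*Hx)^{1/2}$ and $\|x\|_{H^{-1}} = (x^*H^{-1}x)^{1/2}=\|H^{-1/2}x\|_2$ for vectors $x$. For a matrix $V\in\mathbb{C}^{n\times \ell}$, $\|V\|_{H^{-1}} := \|H^{-1/2}V\|_2$ with $\|\cdot\|_2$ the spectral norm. $e_1$ is the first canonical unit vector in $\mathbb{C}^{m+1}$. Flexible Lanczos process with starting vector $r_0$. In each step a vector $\widehat{w}$, meant as an approximation to $H^{-1}w$, is chosen in an arbitrary way (it may come from a different approximate solver in each step). Start: $w = r_0$, choose $\widehat{w}\approx H^{-1}w$, set $\beta_0 = \langle w,\widehat{w}\rangle^{1/2}$, $v_1 = w/\beta_0$, $z_1 = \widehat{w}/\beta_0$, $v_0 = z_0 = 0$. For $k=1,\ldots,m$: set $w = (i\sigma H+B)z_k$; $\alpha_k = \langle w,z_k\rangle$; $\gamma_k = \langle w, z_{k-1}\rangle$; replace $w$ by $w-\alpha_k v_k-\gamma_k v_{k-1}$; choose $\widehat{w}\approx H^{-1}w$; set $\beta_k = \langle w,\widehat{w}\rangle^{1/2}$, $v_{k+1} = w/\beta_k$, $z_{k+1} = \widehat{w}/\beta_k$. "Does not break down" means that all the quantities $\langle w,\widehat{w}\rangle$ whose square roots define $\beta_0,\ldots,\beta_m$ are real and positive. $T_{m+1,m}\in\mathbb{C}^{(m+1)\times m}$ is the tridiagonal matrix with diagonal entries $\alpha_1,\ldots,\alpha_m$ (positions $(k,k)$),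 subdiagonal entries $\beta_1,\ldots,\beta_m$ (positions $(k+1,k)$), superdiagonal entries $\gamma_2,\ldots,\gamma_m$ (positions $(k-1,k)$), and zeros elsewhere. With $Z_m = [z_1,\ldots,z_m]$, the FMR iterate is $x_m = x_0+Z_m\zeta_m$, where $\zeta_m\in\mathbb{C}^m$ is the minimizer of $\|\beta_0e_1-T_{m+1,m}\zeta\|_2$ over $\zeta\in\mathbb{C}^m$. *)

theory Defs
  imports
    Complex_Main
    "Jordan_Normal_Form.Gauss_Jordan_Elimination"
    "Jordan_Normal_Form.Schur_Decomposition"
begin

text \<open>
  The inner product \<open>\<langle>x, y\<rangle> = y\<^sup>* x\<close> is \<open>x \<bullet>c y\<close>, which is linear in its
  first argument. All indices of matrices and vectors start at 0, whereas the sequences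
  of the Lanczos process are numbered as in the usual presentation.
\<close>

definition hermitian_pd :: "nat \<Rightarrow> complex mat \<Rightarrow> bool" where
  "hermitian_pd n H \<longleftrightarrow>
     H \<in> carrier_mat n n \<and> mat_adjoint H = H \<and>
     (\<forall>x \<in> carrier_vec n. x \<noteq> 0\<^sub>v n \<longrightarrow> 0 < Re ((H *\<^sub>v x) \<bullet>c x))"

text \<open>For singular matrices the value is unspecified.\<close>

definition inv_mat :: "complex mat \<Rightarrow> complex mat" where
  "inv_mat H = the (mat_inverse H)"

text \<open>\<open>H\<^sup>-\<^sup>1\<^sup>/\<^sup>2\<close>: the unique Hermitian positive definite square root of \<open>H\<^sup>-\<^sup>1\<close>.\<close>

definition inv_sqrt_mat :: "complex mat \<Rightarrow> complex mat" where
  "inv_sqrt_mat H = (THE R. hermitian_pd (dim_row H) R \<and> R * R = inv_mat H)"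

definition norm2 :: "complex vec \<Rightarrow> real" where
  "norm2 x = sqrt (Re (x \<bullet>c x))"

text \<open>\<open>\<parallel>x\<parallel>\<^sub>H = (x\<^sup>* H x)\<^sup>1\<^sup>/\<^sup>2\<close>; the quadratic form is real as \<open>H\<close> is Hermitian.\<close>

definition weighted_norm :: "complex mat \<Rightarrow> complex vec \<Rightarrow> real" where
  "weighted_norm H x = sqrt (Re ((H *\<^sub>v x) \<bullet>c x))"

definition spectral_norm :: "complex mat \<Rightarrow> real" where
  "spectral_norm M = (SUP x \<in> {x \<in> carrier_vec (dim_col M). norm2 x \<le> 1}. norm2 (M *\<^sub>v x))"

definition inv_weighted_mat_norm :: "complex mat \<Rightarrow> complex mat \<Rightarrow> real" where
  "inv_weighted_mat_norm H V = spectral_norm (inv_sqrt_mat H * V)"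

text \<open>
  \<open>m\<close> steps of the flexible Lanczos process for the matrix \<open>M\<close> with starting vector \<open>r0\<close>.
  Here \<open>w k\<close> is the vector from which \<open>v (k + 1)\<close> is obtained by scaling, that is, the
  start vector for \<open>k = 0\<close> and the value of \<open>w\<close> at the end of step \<open>k\<close> otherwise. The
  vector \<open>wh k\<close> is the one chosen as an approximation to \<open>H\<^sup>-\<^sup>1 w k\<close>; it is an arbitrary
  vector of length \<open>n\<close>. Without breakdown the complex square root \<open>csqrt\<close> is taken of
  positive reals only, so that all \<open>\<beta> k\<close> are positive reals.
\<close>

definition flexible_lanczos ::
  "nat \<Rightarrow> complex mat \<Rightarrow> complex vec \<Rightarrow> nat \<Rightarrow>
   (nat \<Rightarrow> complex vec) \<Rightarrow> (nat \<Rightarrow> complex vec) \<Rightarrow>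
   (nat \<Rightarrow> complex) \<Rightarrow> (nat \<Rightarrow> complex) \<Rightarrow> (nat \<Rightarrow> complex) \<Rightarrow>
   (nat \<Rightarrow> complex vec) \<Rightarrow> (nat \<Rightarrow> complex vec) \<Rightarrow> bool" where
  "flexible_lanczos n M r0 m w wh \<alpha> \<beta> \<gamma> v z \<longleftrightarrow>
     w 0 = r0 \<and> v 0 = 0\<^sub>v n \<and> z 0 = 0\<^sub>v n \<and>
     (\<forall>k \<le> m.
        wh k \<in> carrier_vec n \<and>
        \<beta> k = csqrt (w k \<bullet>c wh k) \<and>
        v (k + 1) = (1 / \<beta> k) \<cdot>\<^sub>v w k \<and>
        z (k + 1) = (1 / \<beta> k) \<cdot>\<^sub>v wh k) \<and>
     (\<forall>k \<in> {1..m}.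
        \<alpha> k = (M *\<^sub>v z k) \<bullet>c z k \<and>
        \<gamma> k = (M *\<^sub>v z k) \<bullet>c z (k - 1) \<and>
        w k = M *\<^sub>v z k - \<alpha> k \<cdot>\<^sub>v v k - \<gamma> k \<cdot>\<^sub>v v (k - 1))"

definition no_breakdown ::
  "nat \<Rightarrow> (nat \<Rightarrow> complex vec) \<Rightarrow> (nat \<Rightarrow> complex vec) \<Rightarrow> bool" where
  "no_breakdown m w wh \<longleftrightarrow> (\<forall>k \<le> m. w k \<bullet>c wh k \<in> \<real> \<and> 0 < Re (w k \<bullet>c wh k))"

text \<open>The \<open>(m + 1) \<times> m\<close> tridiagonal matrix; column \<open>j\<close> belongs to step \<open>j + 1\<close>.\<close>

definition lanczos_T ::
  "nat \<Rightarrow> (nat \<Rightarrow> complex) \<Rightarrow> (nat \<Rightarrow> complex) \<Rightarrow> (nat \<Rightarrow> complex) \<Rightarrow> complex mat" where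
  "lanczos_T m \<alpha> \<beta> \<gamma> = mat (m + 1) m (\<lambda>(i, j).
     if i = j then \<alpha> (j + 1)
     else if i = j + 1 then \<beta> (j + 1)
     else if i + 1 = j then \<gamma> (j + 1)
     else 0)"

text \<open>The matrix with columns \<open>u 1, \<dots>, u l\<close>.\<close>

definition cols_upto :: "nat \<Rightarrow> nat \<Rightarrow> (nat \<Rightarrow> complex vec) \<Rightarrow> complex mat" where
  "cols_upto n l u = mat_of_cols n (map u [1..<l + 1])"

definition fmr_residual ::
  "nat \<Rightarrow> (nat \<Rightarrow> complex) \<Rightarrow> (nat \<Rightarrow> complex) \<Rightarrow> (nat \<Rightarrow> complex) \<Rightarrow> complex vec \<Rightarrow> real" where
  "fmr_residual m \<alpha> \<beta> \<gamma> \<zeta> =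
     norm2 (\<beta> 0 \<cdot>\<^sub>v unit_vec (m + 1) 0 - lanczos_T m \<alpha> \<beta> \<gamma> *\<^sub>v \<zeta>)"

text \<open>
  Without breakdown \<open>lanczos_T m \<alpha> \<beta> \<gamma>\<close> has full column rank, so the minimizer selected by
  \<open>arg_min_on\<close> exists and is unique, and the infimum in \<open>fmr_rho\<close> is a minimum.
\<close>

definition fmr_coeffs ::
  "nat \<Rightarrow> (nat \<Rightarrow> complex) \<Rightarrow> (nat \<Rightarrow> complex) \<Rightarrow> (nat \<Rightarrow> complex) \<Rightarrow> complex vec" where
  "fmr_coeffs m \<alpha> \<beta> \<gamma> = arg_min_on (fmr_residual m \<alpha> \<beta> \<gamma>) (carrier_vec m)"

definition fmr_rho ::
  "nat \<Rightarrow> (nat \<Rightarrow> complex) \<Rightarrow> (nat \<Rightarrow> complex) \<Rightarrow> (nat \<Rightarrow> complex) \<Rightarrow> real" where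
  "fmr_rho m \<alpha> \<beta> \<gamma> = (INF \<zeta> \<in> carrier_vec m. fmr_residual m \<alpha> \<beta> \<gamma> \<zeta>)"

definition fmr_iterate ::
  "nat \<Rightarrow> complex vec \<Rightarrow> nat \<Rightarrow> (nat \<Rightarrow> complex) \<Rightarrow> (nat \<Rightarrow> complex) \<Rightarrow> (nat \<Rightarrow> complex) \<Rightarrow>
   (nat \<Rightarrow> complex vec) \<Rightarrow> complex vec" where
  "fmr_iterate n x0 m \<alpha> \<beta> \<gamma> z = x0 + cols_upto n m z *\<^sub>v fmr_coeffs m \<alpha> \<beta> \<gamma>"

end

theory Submission
  imports Defs "Jordan_Normal_Form.Spectral_Radius" "HOL-Analysis.L2_Norm"
begin

text \<open>
  The process yields the Arnoldi-type relation \<open>M Z\<^sub>m = V\<^sub>m\<^sub>+\<^sub>1 T\<close> with \<open>M = \<i> A\<close>, so \<open>\<i> (b - A x\<^sub>m)\<close>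
  equals \<open>V\<^sub>m\<^sub>+\<^sub>1 (\<beta>\<^sub>0 e\<^sub>1 - T \<zeta>\<^sub>m)\<close>, and the first bound is submultiplicativity of the norm. For the
  second one, the normalisation gives \<open>\<langle>v\<^sub>k, z\<^sub>k\<rangle> = 1\<close>. Writing \<open>g = H\<^sup>-\<^sup>1 v\<^sub>k\<close> and \<open>z\<^sub>k = g + d\<close>, the
  Cauchy-Schwarz inequality in the \<open>H\<close>-inner product yields \<open>1 \<ge> (1 - \<epsilon>) \<parallel>g\<parallel>\<^sub>H\<^sup>2\<close>; hence every column
  of \<open>H\<^sup>-\<^sup>1\<^sup>/\<^sup>2 V\<^sub>m\<^sub>+\<^sub>1\<close> has squared norm at most \<open>1 / (1 - \<epsilon>)\<close>, and the Frobenius norm dominates the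
  spectral norm.
\<close>

subsection \<open>Adjoints and norms\<close>

lemma dim_mat_adjoint [simp]:
  "dim_row (mat_adjoint A) = dim_col A" "dim_col (mat_adjoint A) = dim_row A"
  by (auto simp: mat_adjoint_def)

lemma mat_adjoint_carrier [simp, intro]:
  "A \<in> carrier_mat nr nc \<Longrightarrow> mat_adjoint A \<in> carrier_mat nc nr"
  by (metis carrier_matD carrier_matI dim_mat_adjoint)

lemma index_mat_adjoint [simp]:
  fixes A :: "complex mat"
  shows "i < dim_col A \<Longrightarrow> j < dim_row A \<Longrightarrow> mat_adjoint A $$ (i, j) = cnj (A $$ (j, i))"
  unfolding mat_adjoint_def by (subst mat_of_rows_index) auto

lemma mat_adjoint_adjoint [simp]:
  fixes A :: "complex mat"
  shows "mat_adjoint (mat_adjoint A) = A"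
  by (rule eq_matI) auto

lemma mat_mult_assoc:
  fixes A B C :: "'a :: semiring_0 mat"
  assumes "dim_col A = dim_row B" "dim_col B = dim_row C"
  shows "A * B * C = A * (B * C)"
proof (rule assoc_mult_mat)
  show "A \<in> carrier_mat (dim_row A) (dim_row B)" "B \<in> carrier_mat (dim_row B) (dim_row C)"
    "C \<in> carrier_mat (dim_row C) (dim_col C)"
    using assms by (blast intro: carrier_matI)+
qed

lemma mat_mult_vec_assoc:
  fixes A B :: "'a :: semiring_0 mat"
  assumes "dim_col A = dim_row B" "dim_col B = dim_vec x"
  shows "A * B *\<^sub>v x = A *\<^sub>v (B *\<^sub>v x)"
proof (rule assoc_mult_mat_vec)
  show "A \<in> carrier_mat (dim_row A) (dim_row B)" "B \<in> carrier_mat (dim_row B) (dim_vec x)"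
    "x \<in> carrier_vec (dim_vec x)"
    using assms by (blast intro: carrier_matI carrier_vecI)+
qed

lemma mat_adjoint_mult:
  fixes A B :: "complex mat"
  assumes "dim_col A = dim_row B"
  shows "mat_adjoint (A * B) = mat_adjoint B * mat_adjoint A"
proof (rule eq_matI)
  fix i j assume "i < dim_row (mat_adjoint B * mat_adjoint A)" "j < dim_col (mat_adjoint B * mat_adjoint A)"
  then show "mat_adjoint (A * B) $$ (i, j) = (mat_adjoint B * mat_adjoint A) $$ (i, j)"
    by (simp add: assms scalar_prod_def mult.commute)
qed simp_all

lemma cscalar_prod_sum:
  fixes x y :: "complex vec"
  assumes "x \<in> carrier_vec n" "y \<in> carrier_vec n"
  shows "x \<bullet>c y = (\<Sum>i<n. x $ i * cnj (y $ i))"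
  using assms by (auto simp: scalar_prod_def lessThan_atLeast0)

lemma cscalar_prod_adjoint:
  fixes A :: "complex mat"
  assumes A: "A \<in> carrier_mat nr nc" and x: "x \<in> carrier_vec nc" and y: "y \<in> carrier_vec nr"
  shows "(A *\<^sub>v x) \<bullet>c y = x \<bullet>c (mat_adjoint A *\<^sub>v y)"
proof -
  have "(A *\<^sub>v x) \<bullet>c y = (\<Sum>i<nr. \<Sum>j<nc. A $$ (i, j) * x $ j * cnj (y $ i))"
    using assms by (subst cscalar_prod_sum[of _ nr])
      (auto simp: scalar_prod_def lessThan_atLeast0 sum_distrib_right)
  also have "\<dots> = (\<Sum>j<nc. \<Sum>i<nr. A $$ (i, j) * x $ j * cnj (y $ i))"
    by (rule sum.swap)
  also have "\<dots> = (\<Sum>j<nc. x $ j * cnj ((mat_adjoint A *\<^sub>v y) $ j))"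
    using assms by (auto simp: scalar_prod_def lessThan_atLeast0 sum_distrib_left mult_ac)
  also have "\<dots> = x \<bullet>c (mat_adjoint A *\<^sub>v y)"
    by (rule cscalar_prod_sum[symmetric])
      (use assms mult_mat_vec_carrier[OF mat_adjoint_carrier[OF A] y] in auto)
  finally show ?thesis .
qed

lemma cscalar_prod_cnj:
  fixes x y :: "complex vec"
  assumes "x \<in> carrier_vec n" "y \<in> carrier_vec n"
  shows "cnj (x \<bullet>c y) = y \<bullet>c x"
  using assms by (simp add: cscalar_prod_sum mult.commute)

lemma cscalar_prod_self:
  fixes x :: "complex vec"
  assumes "x \<in> carrier_vec n"
  shows "x \<bullet>c x = complex_of_real (\<Sum>i<n. (cmod (x $ i))\<^sup>2)"
  using assms by (simp add: cscalar_prod_sum complex_norm_square[symmetric])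

lemma norm2_sq_sum:
  assumes "x \<in> carrier_vec n"
  shows "(norm2 x)\<^sup>2 = (\<Sum>i<n. (cmod (x $ i))\<^sup>2)"
  using cscalar_prod_self[OF assms] by (simp add: norm2_def sum_nonneg)

lemma norm2_sq:
  assumes "x \<in> carrier_vec n"
  shows "x \<bullet>c x = complex_of_real ((norm2 x)\<^sup>2)"
  using norm2_sq_sum[OF assms] cscalar_prod_self[OF assms] by simp

lemma norm2_nonneg [simp]: "0 \<le> norm2 x"
  using cscalar_prod_self[OF carrier_vec_dim_vec, of x] by (simp add: norm2_def sum_nonneg)

lemma norm2_eq_0_iff:
  assumes "x \<in> carrier_vec n"
  shows "norm2 x = 0 \<longleftrightarrow> x = 0\<^sub>v n"
  using norm2_sq[OF assms] conjugate_square_eq_0_vec[OF assms] by (metis of_real_eq_0_iff power_eq_0_iff zero_power2)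

lemma norm2_smult:
  assumes "x \<in> carrier_vec n"
  shows "norm2 (c \<cdot>\<^sub>v x) = cmod c * norm2 x"
proof -
  have "(norm2 (c \<cdot>\<^sub>v x))\<^sup>2 = (cmod c * norm2 x)\<^sup>2"
    using assms by (simp add: norm2_sq_sum[of _ n] power_mult_distrib norm_mult sum_distrib_left)
  then show ?thesis by simp
qed

text \<open>The Frobenius norm dominates: Cauchy-Schwarz bounds each entry by a row norm, and
  swapping the double sum regroups the entries by columns. Column norms are the convenient form
  because the columns of \<open>inv_sqrt_mat H * V\<close> are estimated one at a time
  later.\<close>

lemma norm2_mult_mat_vec_le:
  assumes M: "M \<in> carrier_mat nr nc" and x: "x \<in> carrier_vec nc"
  shows "norm2 (M *\<^sub>v x) \<le> sqrt (\<Sum>j<nc. (norm2 (col M j))\<^sup>2) * norm2 x"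
proof -
  have entry: "(cmod ((M *\<^sub>v x) $ i))\<^sup>2 \<le> (\<Sum>j<nc. (cmod (M $$ (i, j)))\<^sup>2) * (norm2 x)\<^sup>2"
    if i: "i < nr" for i
  proof -
    have "(M *\<^sub>v x) $ i = (\<Sum>j<nc. M $$ (i, j) * x $ j)"
      using M x i by (auto simp: scalar_prod_def lessThan_atLeast0)
    then have "cmod ((M *\<^sub>v x) $ i) \<le> (\<Sum>j<nc. cmod (M $$ (i, j)) * cmod (x $ j))"
      by (metis (no_types, lifting) norm_mult norm_sum sum.cong)
    also have "\<dots> \<le> L2_set (\<lambda>j. cmod (M $$ (i, j))) {..<nc} * L2_set (\<lambda>j. cmod (x $ j)) {..<nc}"
      using L2_set_mult_ineq[of "\<lambda>j. cmod (M $$ (i, j))" "\<lambda>j. cmod (x $ j)"] by simp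
    finally have "(cmod ((M *\<^sub>v x) $ i))\<^sup>2
        \<le> (L2_set (\<lambda>j. cmod (M $$ (i, j))) {..<nc} * L2_set (\<lambda>j. cmod (x $ j)) {..<nc})\<^sup>2"
      by (rule power_mono) simp
    also have "\<dots> = (\<Sum>j<nc. (cmod (M $$ (i, j)))\<^sup>2) * (\<Sum>j<nc. (cmod (x $ j))\<^sup>2)"
      by (simp add: L2_set_def power_mult_distrib sum_nonneg)
    finally show ?thesis using norm2_sq_sum[OF x] by simp
  qed
  have "(norm2 (M *\<^sub>v x))\<^sup>2 \<le> (\<Sum>i<nr. (\<Sum>j<nc. (cmod (M $$ (i, j)))\<^sup>2) * (norm2 x)\<^sup>2)"
    using M x by (subst norm2_sq_sum[of _ nr]) (auto intro!: sum_mono entry simp del: index_mult_mat_vec)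
  also have "\<dots> = (\<Sum>j<nc. \<Sum>i<nr. (cmod (M $$ (i, j)))\<^sup>2) * (norm2 x)\<^sup>2"
    by (subst sum.swap) (simp add: sum_distrib_right)
  also have "(\<Sum>j<nc. \<Sum>i<nr. (cmod (M $$ (i, j)))\<^sup>2) = (\<Sum>j<nc. (norm2 (col M j))\<^sup>2)"
    using M by (intro sum.cong) (auto simp: norm2_sq_sum[of _ nr])
  also have "\<dots> * (norm2 x)\<^sup>2 = (sqrt (\<Sum>j<nc. (norm2 (col M j))\<^sup>2) * norm2 x)\<^sup>2"
    by (simp add: power_mult_distrib sum_nonneg)
  finally show ?thesis
    by (rule power2_le_imp_le) (simp add: sum_nonneg)
qed

text \<open>A nonzero \<open>x\<close> is scaled to norm 1, where the supremum applies, and scaled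
  back; for the zero vector both sides vanish.\<close>

lemma spectral_norm_bound:
  assumes "M \<in> carrier_mat nr nc" "x \<in> carrier_vec nc"
  shows "norm2 (M *\<^sub>v x) \<le> spectral_norm M * norm2 x"
proof (cases "x = 0\<^sub>v nc")
  case True
  have "M *\<^sub>v 0\<^sub>v nc = 0\<^sub>v nr"
    using assms by auto
  then show ?thesis
    using True norm2_eq_0_iff[of "0\<^sub>v nr" nr] norm2_eq_0_iff[of "0\<^sub>v nc" nc] by simp
next
  case False
  let ?F = "sqrt (\<Sum>j<nc. (norm2 (col M j))\<^sup>2)"
  let ?c = "complex_of_real (1 / norm2 x)"
  have pos: "norm2 x > 0"
    using False norm2_eq_0_iff[OF assms(2)] norm2_nonneg[of x] by linarith
  \<comment> \<open>A supremum over the reals is an upper bound only of a set known to be bounded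
    above; the Frobenius norm provides the bound.\<close>
  have "bdd_above ((\<lambda>x. norm2 (M *\<^sub>v x)) ` {x \<in> carrier_vec (dim_col M). norm2 x \<le> 1})"
  proof (rule bdd_aboveI2)
    fix y assume "y \<in> {x \<in> carrier_vec (dim_col M). norm2 x \<le> 1}"
    then have "y \<in> carrier_vec nc" "norm2 y \<le> 1" using assms by auto
    then show "norm2 (M *\<^sub>v y) \<le> ?F"
      using norm2_mult_mat_vec_le[OF assms(1), of y] mult_left_le[of "norm2 y" ?F]
      by (auto simp: sum_nonneg)
  qed
  moreover have "?c \<cdot>\<^sub>v x \<in> {x \<in> carrier_vec (dim_col M). norm2 x \<le> 1}"
    using assms pos by (auto simp: norm2_smult norm_divide)
  ultimately have "norm2 (M *\<^sub>v (?c \<cdot>\<^sub>v x)) \<le> spectral_norm M"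
    unfolding spectral_norm_def by (rule cSUP_upper[rotated])
  moreover have "norm2 (M *\<^sub>v (?c \<cdot>\<^sub>v x)) = norm2 (M *\<^sub>v x) / norm2 x"
    using assms pos by (simp add: mult_mat_vec norm2_smult[of _ nr] norm_divide)
  ultimately have "norm2 (M *\<^sub>v x) / norm2 x \<le> spectral_norm M" by (simp only:)
  then show ?thesis by (simp only: pos_divide_le_eq[OF pos])
qed

lemma spectral_norm_le:
  assumes M: "M \<in> carrier_mat nr nc"
  shows "spectral_norm M \<le> sqrt (\<Sum>j<nc. (norm2 (col M j))\<^sup>2)"
  unfolding spectral_norm_def
proof (rule cSUP_least)
  \<comment> \<open>\<open>cSUP_least\<close> asks for a nonempty set; the zero vector lies in the
    unit ball even if \<open>M\<close> has no columns.\<close>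
  have "0\<^sub>v (dim_col M) \<in> {x \<in> carrier_vec (dim_col M). norm2 x \<le> 1}"
    using norm2_eq_0_iff[of "0\<^sub>v (dim_col M)" "dim_col M"] by simp
  then show "{x \<in> carrier_vec (dim_col M). norm2 x \<le> 1} \<noteq> {}" by blast
next
  fix y assume "y \<in> {x \<in> carrier_vec (dim_col M). norm2 x \<le> 1}"
  then show "norm2 (M *\<^sub>v y) \<le> sqrt (\<Sum>j<nc. (norm2 (col M j))\<^sup>2)"
    using M norm2_mult_mat_vec_le[OF M, of y]
      mult_left_le[of "norm2 y" "sqrt (\<Sum>j<nc. (norm2 (col M j))\<^sup>2)"]
    by (auto simp: sum_nonneg)
qed

subsection \<open>The spectral theorem for Hermitian matrices\<close>

text \<open>The diagonal is given by real numbers, so that the reality of Hermitian eigenvalues is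
  part of the representation and the matrix is its own adjoint.\<close>

definition rdiag :: "nat \<Rightarrow> (nat \<Rightarrow> real) \<Rightarrow> complex mat" where
  "rdiag n d = mat n n (\<lambda>(i, j). if i = j then complex_of_real (d i) else 0)"

lemma rdiag_carrier [simp]: "rdiag n d \<in> carrier_mat n n"
  by (simp add: rdiag_def)

lemma dim_rdiag [simp]: "dim_row (rdiag n d) = n" "dim_col (rdiag n d) = n"
  by (simp_all add: rdiag_def)

lemma mat_adjoint_rdiag [simp]: "mat_adjoint (rdiag n d) = rdiag n d"
  by (rule eq_matI) (auto simp: rdiag_def)

lemma rdiag_mult: "rdiag n f * rdiag n g = rdiag n (\<lambda>i. f i * g i)"
  by (rule eq_matI)
    (auto simp: rdiag_def scalar_prod_def if_distrib[where f = "\<lambda>x. x * _"] cong: if_cong)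

lemma rdiag_mult_vec:
  "x \<in> carrier_vec n \<Longrightarrow> rdiag n d *\<^sub>v x = vec n (\<lambda>i. complex_of_real (d i) * x $ i)"
  by (rule eq_vecI)
    (auto simp: rdiag_def scalar_prod_def if_distrib[where f = "\<lambda>x. x * _"] cong: if_cong)

text \<open>Complete \<open>v\<close> to a basis, orthogonalise and normalise the columns.
  Gram-Schmidt leaves its first vector unchanged, so the direction of \<open>v\<close> survives; the
  factor \<open>c\<close> may stay unspecified, as an eigenvector matters only up to
  scaling.\<close>

lemma unitary_first_col:
  fixes v :: "complex vec"
  assumes v: "v \<in> carrier_vec n" and v0: "v \<noteq> 0\<^sub>v n"
  obtains U c where "U \<in> carrier_mat n n" "mat_adjoint U * U = 1\<^sub>m n" "col U 0 = c \<cdot>\<^sub>v v"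
proof -
  have n: "n \<noteq> 0" using v v0 by (auto intro: ccontr)
  interpret cof_vec_space n "TYPE(complex)" .
  note bc = basis_completion[OF v v0]
  define ws where "ws = gram_schmidt n (basis_completion v)"
  obtain vs where bv: "basis_completion v = v # vs"
    using bc(5-) n by (cases "basis_completion v") auto
  note gs = gram_schmidt_result[OF bc(2,4,5) ws_def]
  have len: "length ws = n" using gs bc by simp
  have ws: "ws ! j \<in> carrier_vec n" if "j < n" for j
    using gs(3) len that by auto
  have ws0: "ws ! 0 = v"
    using v n len unfolding ws_def bv by (metis gram_schmidt_hd hd_conv_nth length_0_conv)
  have orth: "ws ! i \<bullet>c ws ! j = 0 \<longleftrightarrow> i \<noteq> j" if "i < n" "j < n" for i j
    using corthogonalD[OF gs(2)] that len by simp
  have pos: "norm2 (ws ! j) \<noteq> 0" if "j < n" for j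
    using orth[OF that that] norm2_sq[OF ws[OF that]] by auto
  define U where "U = mat n n (\<lambda>(i, j). ws ! j $ i / complex_of_real (norm2 (ws ! j)))"
  have U: "U \<in> carrier_mat n n" by (simp add: U_def)
  have "mat_adjoint U * U = 1\<^sub>m n"
  proof (rule eq_matI)
    fix i j assume "i < dim_row (1\<^sub>m n :: complex mat)" "j < dim_col (1\<^sub>m n :: complex mat)"
    then have ij: "i < n" "j < n" by auto
    have "(mat_adjoint U * U) $$ (i, j) =
        (\<Sum>k<n. ws ! j $ k * cnj (ws ! i $ k)) / (norm2 (ws ! i) * norm2 (ws ! j))"
      using ij by (auto simp: U_def scalar_prod_def lessThan_atLeast0 sum_divide_distrib mult_ac)
    also have "\<dots> = (ws ! j \<bullet>c ws ! i) / (norm2 (ws ! i) * norm2 (ws ! j))"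
      using cscalar_prod_sum[OF ws[OF ij(2)] ws[OF ij(1)]] by simp
    also have "\<dots> = 1\<^sub>m n $$ (i, j)"
      using ij orth[of j i] pos norm2_sq[OF ws[OF ij(1)]] by (auto simp: power2_eq_square)
    finally show "(mat_adjoint U * U) $$ (i, j) = 1\<^sub>m n $$ (i, j)" .
  qed (use U in auto)
  moreover have "col U 0 = complex_of_real (1 / norm2 v) \<cdot>\<^sub>v v"
    using v n ws0 by (intro eq_vecI) (auto simp: U_def)
  ultimately show ?thesis using that U by blast
qed

text \<open>Induction on the dimension by deflation: a unitary matrix whose first column is an
  eigenvector reduces the first column of \<open>A\<close> to its diagonal entry, Hermitian symmetry
  clears the first row as well, and the remaining block is Hermitian of size
  \<open>n\<close>.\<close>

theorem hermitian_spectral: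
  fixes A :: "complex mat"
  assumes "A \<in> carrier_mat n n" "mat_adjoint A = A"
  shows "\<exists>U d. U \<in> carrier_mat n n \<and> mat_adjoint U * U = 1\<^sub>m n \<and> mat_adjoint U * A * U = rdiag n d"
  using assms
proof (induction n arbitrary: A)
  case 0
  then show ?case
    by (intro exI[of _ "1\<^sub>m 0"]) (auto intro!: eq_matI)
next
  case (Suc n)
  note A = Suc.prems(1) and herm = Suc.prems(2)
  obtain e where "eigenvalue A e"
    using spectrum_non_empty[OF A] by (auto simp: spectrum_def)
  then obtain v where v: "v \<in> carrier_vec (Suc n)" "v \<noteq> 0\<^sub>v (Suc n)" "A *\<^sub>v v = e \<cdot>\<^sub>v v"
    using A by (auto simp: eigenvalue_def eigenvector_def)
  obtain U c where U: "U \<in> carrier_mat (Suc n) (Suc n)" and UU: "mat_adjoint U * U = 1\<^sub>m (Suc n)"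
    and U0: "col U 0 = c \<cdot>\<^sub>v v"
    using unitary_first_col[OF v(1,2)] .
  let ?U' = "mat_adjoint U"
  have U': "?U' \<in> carrier_mat (Suc n) (Suc n)" using U by auto
  define B where "B = ?U' * A * U"
  have B: "B \<in> carrier_mat (Suc n) (Suc n)" using U A by (auto simp: B_def)
  have Bherm: "mat_adjoint B = B"
    unfolding B_def using herm
    by (simp add: carrier_matD[OF U] carrier_matD[OF A] mat_adjoint_mult mat_mult_assoc)
  have Bcnj: "B $$ (i, j) = cnj (B $$ (j, i))" if "i < Suc n" "j < Suc n" for i j
    using index_mat_adjoint[of i B j] Bherm B that by simp
  \<comment> \<open>Column 0 of \<open>U\<close> is a multiple of an eigenvector, so
    \<open>A\<close> acts on it as the scalar \<open>e\<close>, and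
    \<open>mat_adjoint U * U = 1\<close> turns the result into \<open>e\<close> times the first unit
    vector.\<close>
  have Bi0: "B $$ (i, 0) = (if i = 0 then e else 0)" if i: "i < Suc n" for i
  proof -
    have "B $$ (i, 0) = row ?U' i \<bullet> (A *\<^sub>v col U 0)"
      unfolding B_def assoc_mult_mat[OF U' A U] col_mult2[OF A U zero_less_Suc, symmetric]
      using i by (intro index_mult_mat) (simp_all add: carrier_matD[OF U])
    also have "A *\<^sub>v col U 0 = e \<cdot>\<^sub>v col U 0"
      using U0 v A by (simp add: mult_mat_vec smult_smult_assoc mult.commute)
    also have "row ?U' i \<bullet> (e \<cdot>\<^sub>v col U 0) = e * (?U' * U) $$ (i, 0)"
      using i U U' by (subst scalar_prod_smult_right) auto
    finally show ?thesis using UU i by auto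
  qed
  have B0j: "B $$ (0, j) = 0" if "0 < j" "j < Suc n" for j
    using Bcnj[of 0 j] Bi0[of j] that by simp
  \<comment> \<open>The corner entry of a Hermitian matrix equals its own conjugate, so the
    eigenvalue is real, as \<open>rdiag\<close> demands.\<close>
  have "cnj e = e" using Bcnj[of 0 0] Bi0[of 0] by simp
  then have e: "complex_of_real (Re e) = e" by (simp add: complex_eq_iff)
  define B3 where "B3 = mat n n (\<lambda>(i, j). B $$ (Suc i, Suc j))"
  have B3: "B3 \<in> carrier_mat n n" by (simp add: B3_def)
  have "mat_adjoint B3 = B3"
    by (rule eq_matI) (auto simp: B3_def Bcnj[symmetric])
  then obtain V d where V: "V \<in> carrier_mat n n" and VV: "mat_adjoint V * V = 1\<^sub>m n"
    and VB: "mat_adjoint V * B3 * V = rdiag n d"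
    using Suc.IH[OF B3] by blast
  let ?E = "mat 1 1 (\<lambda>_. e)"
  \<comment> \<open>\<open>X\<close> keeps the eigenvector and diagonalises the remaining block;
    \<open>U * X\<close> is then the unitary matrix sought.\<close>
  define X where "X = four_block_mat (1\<^sub>m 1) (0\<^sub>m 1 n) (0\<^sub>m n 1) V"
  have X: "X \<in> carrier_mat (Suc n) (Suc n)" using V by (auto simp: X_def)
  have X': "mat_adjoint X = four_block_mat (1\<^sub>m 1) (0\<^sub>m 1 n) (0\<^sub>m n 1) (mat_adjoint V)"
    using V by (intro eq_matI) (auto simp: X_def)
  have Bblock: "B = four_block_mat ?E (0\<^sub>m 1 n) (0\<^sub>m n 1) B3"
    using B by (intro eq_matI) (auto simp: B3_def Bi0 B0j)
  have XX: "mat_adjoint X * X = 1\<^sub>m (Suc n)"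
    unfolding X' unfolding X_def using V VV
    by (subst mult_four_block_mat[of _ 1 1 _ n _ n _ _ 1 _ n]) auto
  have V'B: "mat_adjoint V * B3 \<in> carrier_mat n n"
    by (rule mult_carrier_mat[OF mat_adjoint_carrier[OF V] B3])
  have "mat_adjoint X * B = four_block_mat ?E (0\<^sub>m 1 n) (0\<^sub>m n 1) (mat_adjoint V * B3)"
    unfolding X' Bblock using V B3 V'B
    by (subst mult_four_block_mat[of _ 1 1 _ n _ n _ _ 1 _ n]) auto
  then have "mat_adjoint X * B * X = four_block_mat ?E (0\<^sub>m 1 n) (0\<^sub>m n 1) (rdiag n d)"
    unfolding X_def VB[symmetric] using V V'B
    by (simp only:, subst mult_four_block_mat[of _ 1 1 _ n _ n _ _ 1 _ n]) auto
  also have "\<dots> = rdiag (Suc n) (case_nat (Re e) d)"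
    using e by (intro eq_matI) (auto simp: rdiag_def split: nat.splits)
  finally have XBX: "mat_adjoint X * B * X = rdiag (Suc n) (case_nat (Re e) d)" .
  have "mat_adjoint (U * X) * (U * X) = mat_adjoint X * (?U' * U) * X"
    by (simp add: carrier_matD[OF U] carrier_matD[OF X] mat_adjoint_mult
        mat_mult_assoc)
  then have 1: "mat_adjoint (U * X) * (U * X) = 1\<^sub>m (Suc n)"
    using UU XX X by simp
  have "mat_adjoint (U * X) * A * (U * X) = mat_adjoint X * B * X"
    unfolding B_def
    by (simp add: carrier_matD[OF U] carrier_matD[OF X] carrier_matD[OF A] mat_adjoint_mult
        mat_mult_assoc)
  then show ?case using 1 XBX U X by (intro exI[of _ "U * X"]) auto
qed

subsection \<open>Positive definite matrices\<close>

lemma hermitian_pdD: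
  assumes "hermitian_pd n H"
  shows "H \<in> carrier_mat n n" "mat_adjoint H = H"
    "x \<in> carrier_vec n \<Longrightarrow> x \<noteq> 0\<^sub>v n \<Longrightarrow> 0 < Re ((H *\<^sub>v x) \<bullet>c x)"
  using assms by (auto simp: hermitian_pd_def)

lemma hermitian_pd_nonneg:
  assumes "hermitian_pd n H" "x \<in> carrier_vec n"
  shows "0 \<le> Re ((H *\<^sub>v x) \<bullet>c x)"
proof (cases "x = 0\<^sub>v n")
  case True
  then show ?thesis using hermitian_pdD(1)[OF assms(1)] by simp
qed (use hermitian_pdD(3)[OF assms] in auto)

lemma hermitian_pd_rdiag:
  assumes "\<And>i. i < n \<Longrightarrow> 0 < d i"
  shows "hermitian_pd n (rdiag n d)"
  unfolding hermitian_pd_def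
proof (intro conjI ballI impI)
  fix x :: "complex vec" assume x: "x \<in> carrier_vec n" "x \<noteq> 0\<^sub>v n"
  then obtain i where i: "i < n" "x $ i \<noteq> 0" by (auto simp: vec_eq_iff)
  have "(rdiag n d *\<^sub>v x) \<bullet>c x = (\<Sum>i<n. complex_of_real (d i) * x $ i * cnj (x $ i))"
    using x by (simp add: rdiag_mult_vec cscalar_prod_sum[of _ n])
  also have "\<dots> = complex_of_real (\<Sum>i<n. d i * (cmod (x $ i))\<^sup>2)"
    unfolding of_real_sum
    by (rule sum.cong[OF refl]) (simp add: complex_norm_square[symmetric] mult.assoc)
  finally have "Re ((rdiag n d *\<^sub>v x) \<bullet>c x) = (\<Sum>i<n. d i * (cmod (x $ i))\<^sup>2)" by simp
  also have "\<dots> > 0"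
    using i assms by (intro sum_pos2[of _ i]) (auto simp: less_imp_le)
  finally show "0 < Re ((rdiag n d *\<^sub>v x) \<bullet>c x)" .
qed auto

text \<open>The form at \<open>x\<close> equals the form of \<open>D\<close> at
  \<open>U *\<^sub>v x\<close>, which is nonzero by injectivity. Rectangular \<open>U\<close> is
  allowed, so that the Gram matrix of a least squares problem is covered too.\<close>

lemma hermitian_pd_congruence:
  assumes "hermitian_pd k D" and U: "U \<in> carrier_mat k n"
    and inj: "\<And>x. x \<in> carrier_vec n \<Longrightarrow> U *\<^sub>v x = 0\<^sub>v k \<Longrightarrow> x = 0\<^sub>v n"
  shows "hermitian_pd n (mat_adjoint U * D * U)"
proof -
  note D = hermitian_pdD[OF assms(1)]
  have U': "mat_adjoint U \<in> carrier_mat n k" using U by auto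
  have "mat_adjoint (mat_adjoint U * D * U) = mat_adjoint U * D * U"
    using D(2) by (simp add: carrier_matD[OF U] carrier_matD[OF D(1)] mat_adjoint_mult mat_mult_assoc)
  moreover have "0 < Re ((mat_adjoint U * D * U *\<^sub>v x) \<bullet>c x)"
    if x: "x \<in> carrier_vec n" "x \<noteq> 0\<^sub>v n" for x
  proof -
    have Ux: "U *\<^sub>v x \<in> carrier_vec k" using U x by auto
    have "mat_adjoint U * D * U *\<^sub>v x = mat_adjoint U *\<^sub>v (D *\<^sub>v (U *\<^sub>v x))"
      by (simp add: mat_mult_vec_assoc carrier_matD[OF U] carrier_matD[OF D(1)] carrier_vecD[OF x(1)])
    then have "(mat_adjoint U * D * U *\<^sub>v x) \<bullet>c x = (D *\<^sub>v (U *\<^sub>v x)) \<bullet>c (U *\<^sub>v x)"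
      using cscalar_prod_adjoint[OF U' mult_mat_vec_carrier[OF D(1) Ux] x(1)] by simp
    then show ?thesis using D(3)[OF Ux] inj x by auto
  qed
  ultimately show ?thesis
    using mult_carrier_mat[OF mult_carrier_mat[OF U' D(1)] U] unfolding hermitian_pd_def by blast
qed

lemma hermitian_pd_one: "hermitian_pd n (1\<^sub>m n)"
proof -
  have "rdiag n (\<lambda>_. 1) = 1\<^sub>m n" by (intro eq_matI) (auto simp: rdiag_def)
  then show ?thesis using hermitian_pd_rdiag[of n "\<lambda>_. 1"] by simp
qed

text \<open>A nonzero kernel vector would make the quadratic form vanish, so the determinant is
  nonzero and \<open>mat_inverse\<close> does return a matrix.\<close>

lemma hermitian_pd_inv_mat:
  assumes "hermitian_pd n H"
  shows "inv_mat H \<in> carrier_mat n n" "H * inv_mat H = 1\<^sub>m n" "inv_mat H * H = 1\<^sub>m n"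
proof -
  note H = hermitian_pdD[OF assms]
  have "det H \<noteq> 0"
  proof
    assume "det H = 0"
    then obtain x where x: "x \<in> carrier_vec n" "x \<noteq> 0\<^sub>v n" "H *\<^sub>v x = 0\<^sub>v n"
      using det_0_iff_vec_prod_zero[OF H(1)] by blast
    show False using H(3)[OF x(1,2)] x(1) by (simp add: x(3))
  qed
  then have "H \<in> Units (ring_mat TYPE(complex) n ())"
    by (rule det_non_zero_imp_unit[OF H(1)])
  then obtain G where "mat_inverse H = Some G"
    using mat_inverse(1)[OF H(1)] by fastforce
  then show "inv_mat H \<in> carrier_mat n n" "H * inv_mat H = 1\<^sub>m n" "inv_mat H * H = 1\<^sub>m n"
    using mat_inverse(2)[OF H(1)] by (auto simp: inv_mat_def)
qed

lemma mult_inv_mat_vec: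
  assumes "hermitian_pd n H" "x \<in> carrier_vec n"
  shows "H *\<^sub>v (inv_mat H *\<^sub>v x) = x"
  using assoc_mult_mat_vec[OF hermitian_pdD(1)[OF assms(1)] hermitian_pd_inv_mat(1)[OF assms(1)] assms(2)]
    one_mult_mat_vec[OF assms(2)] by (simp only: hermitian_pd_inv_mat(2)[OF assms(1)])

text \<open>Taking adjoints in \<open>H * inv_mat H = 1\<close> shows that the adjoint of the
  inverse is again a left inverse of \<open>H\<close>. Hence \<open>inv_mat H\<close> is the
  congruence of \<open>H\<close> by \<open>inv_mat H\<close> itself and inherits positivity.\<close>

lemma hermitian_pd_inv:
  assumes "hermitian_pd n H"
  shows "hermitian_pd n (inv_mat H)"
proof -
  note H = hermitian_pdD[OF assms] and I = hermitian_pd_inv_mat[OF assms]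
  have "mat_adjoint (inv_mat H) * H = mat_adjoint (H * inv_mat H)"
    using H(2) by (simp add: mat_adjoint_mult carrier_matD[OF H(1)] carrier_matD[OF I(1)])
  also have "\<dots> = 1\<^sub>m n"
    unfolding I(2) by (rule eq_matI) auto
  finally have adj: "mat_adjoint (inv_mat H) * H = 1\<^sub>m n" .
  have "mat_adjoint (inv_mat H) * H * inv_mat H = mat_adjoint (inv_mat H)"
    using I(2) by (simp add: mat_mult_assoc carrier_matD[OF H(1)] carrier_matD[OF I(1)]
        right_mult_one_mat[of _ n n] mat_adjoint_carrier[OF I(1)])
  then have "mat_adjoint (inv_mat H) * H * inv_mat H = inv_mat H"
    using adj I by simp
  moreover have "hermitian_pd n (mat_adjoint (inv_mat H) * H * inv_mat H)"
  proof (rule hermitian_pd_congruence[OF assms I(1)])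
    fix x assume "x \<in> carrier_vec n" "inv_mat H *\<^sub>v x = 0\<^sub>v n"
    then show "x = 0\<^sub>v n" using mult_inv_mat_vec[OF assms, of x] H by auto
  qed
  ultimately show ?thesis by simp
qed

section \<open>Square roots of positive definite matrices\<close>

lemma unitary_comm:
  fixes U :: "complex mat"
  assumes "U \<in> carrier_mat n n" "mat_adjoint U * U = 1\<^sub>m n"
  shows "U * mat_adjoint U = 1\<^sub>m n"
  using mat_mult_left_right_inverse[OF mat_adjoint_carrier[OF assms(1)] assms] .

text \<open>Diagonalise, take the roots of the eigenvalues, and transform back.\<close>

lemma pd_sqrt_exists:
  assumes "hermitian_pd n P"
  shows "\<exists>R. hermitian_pd n R \<and> R * R = P"
proof -
  note P = hermitian_pdD[OF assms]
  obtain U d where U: "U \<in> carrier_mat n n" and UU: "mat_adjoint U * U = 1\<^sub>m n"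
    and UPU: "mat_adjoint U * P * U = rdiag n d"
    using hermitian_spectral[OF P(1,2)] by blast
  let ?U' = "mat_adjoint U"
  have U': "?U' \<in> carrier_mat n n" using U by auto
  have UU': "U * ?U' = 1\<^sub>m n" by (rule unitary_comm[OF U UU])
  \<comment> \<open>A matrix with a left inverse is injective. This is stated for general factors
    because congruences by both \<open>U\<close> and its adjoint follow.\<close>
  have inj: "x = 0\<^sub>v n" if "V * W = 1\<^sub>m n" "V \<in> carrier_mat n n" "W \<in> carrier_mat n n"
      "x \<in> carrier_vec n" "W *\<^sub>v x = 0\<^sub>v n" for V W :: "complex mat" and x
  proof -
    have "x = V *\<^sub>v (W *\<^sub>v x)"
      using that(1,4) by (simp add: mat_mult_vec_assoc[symmetric] carrier_matD[OF that(2)]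
          carrier_matD[OF that(3)] carrier_vecD[OF that(4)])
    then show ?thesis using that(2) by (auto simp: that(5))
  qed
  have pd: "hermitian_pd n (rdiag n d)"
    using hermitian_pd_congruence[OF assms U inj[OF UU U' U]] unfolding UPU .
  \<comment> \<open>The diagonal matrix is congruent to \<open>P\<close>, hence positive definite;
    evaluating its form at a unit vector reads off one eigenvalue.\<close>
  have d: "0 < d i" if i: "i < n" for i
  proof -
    have "rdiag n d *\<^sub>v unit_vec n i = complex_of_real (d i) \<cdot>\<^sub>v unit_vec n i"
      unfolding rdiag_mult_vec[OF unit_vec_carrier] by (rule eq_vecI) (auto simp: unit_vec_def)
    then have "(rdiag n d *\<^sub>v unit_vec n i) \<bullet>c unit_vec n i = complex_of_real (d i)"
      using i by simp
    moreover have "unit_vec n i \<noteq> (0\<^sub>v n :: complex vec)"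
      using i by (metis index_unit_vec(2) index_zero_vec(1) zero_neq_one)
    ultimately show ?thesis
      using hermitian_pdD(3)[OF pd, of "unit_vec n i"] by simp
  qed
  let ?D = "rdiag n (\<lambda>i. sqrt (d i))"
  define R where "R = U * ?D * ?U'"
  have "hermitian_pd n (mat_adjoint ?U' * ?D * ?U')"
    by (rule hermitian_pd_congruence[OF _ U' inj[OF UU' U U']])
      (auto intro!: hermitian_pd_rdiag d)
  then have "hermitian_pd n R" by (simp add: R_def)
  moreover have "R * R = P"
  proof -
    have D: "?D * ?D = rdiag n d"
      unfolding rdiag_mult by (rule eq_matI) (auto simp: rdiag_def d less_imp_le)
    have "R * R = U * ?D * (?U' * U) * ?D * ?U'"
      by (simp add: carrier_matD[OF U] left_mult_one_mat[of _ n n] R_def mat_mult_assoc)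
    also have "\<dots> = U * (?D * ?D) * ?U'"
      by (simp add: carrier_matD[OF U] left_mult_one_mat[of _ n n] UU mat_mult_assoc)
    also have "\<dots> = (U * ?U') * P * (U * ?U')"
      unfolding D UPU[symmetric]
      by (simp add: carrier_matD[OF U] carrier_matD[OF P(1)] mat_mult_assoc)
    finally show ?thesis using UU' P by simp
  qed
  ultimately show ?thesis by blast
qed

text \<open>The difference \<open>D\<close> of two square roots \<open>R\<close>, \<open>R'\<close> satisfies \<open>R D + D R' = 0\<close>; pairing
  this with an eigenvector of \<open>D\<close> shows that all eigenvalues of \<open>D\<close> vanish.\<close>

lemma pd_sqrt_unique:
  assumes "hermitian_pd n R" "hermitian_pd n R'" "R * R = R' * R'"
  shows "R = R'"
proof -
  note R = hermitian_pdD[OF assms(1)] and R' = hermitian_pdD[OF assms(2)]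
  define D where "D = R - R'"
  have D: "D \<in> carrier_mat n n" using R R' by (auto simp: D_def)
  have Dadj: "mat_adjoint D = D"
  proof (rule eq_matI)
    fix i j assume ij: "i < dim_row D" "j < dim_col D"
    then show "mat_adjoint D $$ (i, j) = D $$ (i, j)"
      using D R(1) R'(1) index_mat_adjoint[of i R j] index_mat_adjoint[of i R' j]
      by (auto simp: D_def R(2) R'(2))
  qed (use D in auto)
  obtain U d where U: "U \<in> carrier_mat n n" and UU: "mat_adjoint U * U = 1\<^sub>m n"
    and UDU: "mat_adjoint U * D * U = rdiag n d"
    using hermitian_spectral[OF D Dadj] by blast
  let ?U' = "mat_adjoint U"
  have U': "?U' \<in> carrier_mat n n" using U by auto
  have UU': "U * ?U' = 1\<^sub>m n" by (rule unitary_comm[OF U UU])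
  have "U * rdiag n d = (U * ?U') * D * U"
    unfolding UDU[symmetric]
    by (simp add: carrier_matD[OF U] carrier_matD[OF D] mat_mult_assoc)
  then have DU: "D * U = U * rdiag n d" using UU' D by simp
  have "d i = 0" if i: "i < n" for i
  proof -
    let ?u = "col U i"
    have u: "?u \<in> carrier_vec n" using U by auto
    have u0: "?u \<noteq> 0\<^sub>v n"
    proof
      assume "?u = 0\<^sub>v n"
      then have "(?U' * U) $$ (i, i) = 0" using U U' i by (subst index_mult_mat) auto
      then show False using UU i by simp
    qed
    have "D *\<^sub>v ?u = U *\<^sub>v col (rdiag n d) i"
      using col_mult2[OF D U i] col_mult2[OF U rdiag_carrier i] by (simp add: DU)
    also have "col (rdiag n d) i = complex_of_real (d i) \<cdot>\<^sub>v unit_vec n i"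
      using i by (intro eq_vecI) (auto simp: rdiag_def)
    also have "U *\<^sub>v \<dots> = complex_of_real (d i) \<cdot>\<^sub>v (U *\<^sub>v unit_vec n i)"
      by (rule mult_mat_vec[OF U]) simp
    also have "U *\<^sub>v unit_vec n i = ?u"
      using U i by (intro eq_vecI) auto
    finally have Du: "D *\<^sub>v ?u = complex_of_real (d i) \<cdot>\<^sub>v ?u" .
    have Ru: "R *\<^sub>v ?u \<in> carrier_vec n" and R'u: "R' *\<^sub>v ?u \<in> carrier_vec n"
      using R R' u by auto
    \<comment> \<open>The mixed products \<open>R * R'\<close> cancel, leaving the difference of the
      two squares.\<close>
    have "R * D + D * R' = 0\<^sub>m n n"
      unfolding D_def using R R' assms(3)
      by (simp add: mult_minus_distrib_mat[of _ n n _ n] minus_mult_distrib_mat[of _ n n _ _ n])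
        (auto intro!: eq_matI)
    then have "(R * D + D * R') *\<^sub>v ?u = 0\<^sub>v n"
      using u by (auto intro!: eq_vecI)
    moreover have "(R * D + D * R') *\<^sub>v ?u = R *\<^sub>v (D *\<^sub>v ?u) + D *\<^sub>v (R' *\<^sub>v ?u)"
      unfolding add_mult_distrib_mat_vec[OF mult_carrier_mat[OF R(1) D] mult_carrier_mat[OF D R'(1)] u]
        assoc_mult_mat_vec[OF R(1) D u] assoc_mult_mat_vec[OF D R'(1) u] ..
    ultimately have "0 = (R *\<^sub>v (D *\<^sub>v ?u) + D *\<^sub>v (R' *\<^sub>v ?u)) \<bullet>c ?u" using u by simp
    also have "\<dots> = (R *\<^sub>v (D *\<^sub>v ?u)) \<bullet>c ?u + (D *\<^sub>v (R' *\<^sub>v ?u)) \<bullet>c ?u"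
      using R D u Ru R'u by (subst add_scalar_prod_distrib[of _ n]) auto
    also have "(D *\<^sub>v (R' *\<^sub>v ?u)) \<bullet>c ?u = complex_of_real (d i) * ((R' *\<^sub>v ?u) \<bullet>c ?u)"
      using cscalar_prod_adjoint[OF D R'u u] Dadj Du u R'u by (simp add: conjugate_smult_vec)
    also have "(R *\<^sub>v (D *\<^sub>v ?u)) \<bullet>c ?u = complex_of_real (d i) * ((R *\<^sub>v ?u) \<bullet>c ?u)"
      unfolding Du mult_mat_vec[OF R(1) u]
      by (rule smult_scalar_prod_distrib[OF Ru carrier_vec_conjugate[OF u]])
    \<comment> \<open>Both quadratic forms are positive at the nonzero vector \<open>?u\<close>, so
      the other factor \<open>d i\<close> has to vanish.\<close>
    finally have "d i * (Re ((R *\<^sub>v ?u) \<bullet>c ?u) + Re ((R' *\<^sub>v ?u) \<bullet>c ?u)) = 0"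
      by (simp add: complex_eq_iff algebra_simps)
    then show ?thesis using R(3)[OF u u0] R'(3)[OF u u0] by simp
  qed
  then have "rdiag n d = 0\<^sub>m n n" by (intro eq_matI) (auto simp: rdiag_def)
  then have "D * U = 0\<^sub>m n n" using DU U by simp
  then have "D = 0\<^sub>m n n"
    using assoc_mult_mat[OF D U U'] left_mult_zero_mat[OF U'] D by (simp add: UU')
  then have "D $$ (i, j) = 0" if "i < n" "j < n" for i j using that by simp
  then show ?thesis
    using R(1) R'(1) by (intro eq_matI) (auto simp: D_def)
qed

text \<open>Existence and uniqueness of the root ensure that the description by \<open>THE\<close>
  denotes it.\<close>

lemma inv_sqrt_mat:
  assumes "hermitian_pd n H"
  shows "hermitian_pd n (inv_sqrt_mat H)" "inv_sqrt_mat H * inv_sqrt_mat H = inv_mat H"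
proof -
  have "\<exists>!R. hermitian_pd (dim_row H) R \<and> R * R = inv_mat H"
    unfolding carrier_matD(1)[OF hermitian_pdD(1)[OF assms]]
    using pd_sqrt_exists[OF hermitian_pd_inv[OF assms]]
    by (rule ex_ex1I) (rule pd_sqrt_unique[of n], simp_all)
  from theI'[OF this] show "hermitian_pd n (inv_sqrt_mat H)"
      "inv_sqrt_mat H * inv_sqrt_mat H = inv_mat H"
    using hermitian_pdD(1)[OF assms] by (auto simp: inv_sqrt_mat_def)
qed

section \<open>Weighted norms and their Cauchy-Schwarz inequality\<close>

lemma weighted_norm_inv_mat:
  assumes "hermitian_pd n H" "x \<in> carrier_vec n"
  shows "weighted_norm (inv_mat H) x = norm2 (inv_sqrt_mat H *\<^sub>v x)"
proof -
  let ?R = "inv_sqrt_mat H"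
  note R = hermitian_pdD[OF inv_sqrt_mat(1)[OF assms(1)]]
  have Rx: "?R *\<^sub>v x \<in> carrier_vec n" using R assms by auto
  have "inv_mat H *\<^sub>v x = ?R *\<^sub>v (?R *\<^sub>v x)"
    using R assms by (simp add: inv_sqrt_mat(2)[OF assms(1), symmetric])
  then show ?thesis
    using cscalar_prod_adjoint[OF R(1) Rx assms(2)] R(2)
    by (simp add: weighted_norm_def norm2_def)
qed

text \<open>This links the accuracy condition, stated in the norm of \<open>H\<close>, with the dual
  norm in which the basis vectors are measured.\<close>

lemma weighted_norm_inv_mat_vec:
  assumes "hermitian_pd n H" "x \<in> carrier_vec n"
  shows "weighted_norm H (inv_mat H *\<^sub>v x) = weighted_norm (inv_mat H) x"
proof -
  note I = hermitian_pdD[OF hermitian_pd_inv[OF assms(1)]]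
  show ?thesis
    using cscalar_prod_adjoint[OF I(1) assms(2,2)] I(2)
    by (simp add: weighted_norm_def mult_inv_mat_vec[OF assms])
qed

lemma weighted_norm_sq:
  assumes "hermitian_pd n H" "x \<in> carrier_vec n"
  shows "(weighted_norm H x)\<^sup>2 = Re ((H *\<^sub>v x) \<bullet>c x)"
  using hermitian_pd_nonneg[OF assms] by (simp add: weighted_norm_def)

text \<open>A square root \<open>R\<close> of \<open>H\<close> turns the weighted form into the
  Euclidean inner product of \<open>R *\<^sub>v x\<close> and \<open>R *\<^sub>v y\<close>.\<close>

lemma weighted_Cauchy_Schwarz:
  assumes "hermitian_pd n H" "x \<in> carrier_vec n" "y \<in> carrier_vec n"
  shows "\<bar>Re ((H *\<^sub>v x) \<bullet>c y)\<bar> \<le> weighted_norm H x * weighted_norm H y"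
proof -
  note H = hermitian_pdD[OF assms(1)]
  obtain R where "hermitian_pd n R" and RR: "R * R = H"
    using pd_sqrt_exists[OF assms(1)] by blast
  note R = hermitian_pdD[OF \<open>hermitian_pd n R\<close>]
  have Rx: "R *\<^sub>v x \<in> carrier_vec n" and Ry: "R *\<^sub>v y \<in> carrier_vec n"
    using R assms by auto
  have eq: "(H *\<^sub>v u) \<bullet>c w = (R *\<^sub>v u) \<bullet>c (R *\<^sub>v w)"
    if "u \<in> carrier_vec n" "w \<in> carrier_vec n" for u w
    using cscalar_prod_adjoint[OF R(1) mult_mat_vec_carrier[OF R(1) that(1)] that(2)]
    unfolding R(2) RR[symmetric] assoc_mult_mat_vec[OF R(1,1) that(1)] .
  have "\<bar>Re ((H *\<^sub>v x) \<bullet>c y)\<bar> \<le> cmod (\<Sum>i<n. (R *\<^sub>v x) $ i * cnj ((R *\<^sub>v y) $ i))"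
    unfolding eq[OF assms(2,3)] cscalar_prod_sum[OF Rx Ry] by (rule abs_Re_le_cmod)
  also have "\<dots> \<le> (\<Sum>i<n. cmod ((R *\<^sub>v x) $ i) * cmod ((R *\<^sub>v y) $ i))"
    by (rule order_trans[OF norm_sum]) (simp add: norm_mult)
  also have "\<dots> \<le> L2_set (\<lambda>i. cmod ((R *\<^sub>v x) $ i)) {..<n} * L2_set (\<lambda>i. cmod ((R *\<^sub>v y) $ i)) {..<n}"
    using L2_set_mult_ineq[of "\<lambda>i. cmod ((R *\<^sub>v x) $ i)" "\<lambda>i. cmod ((R *\<^sub>v y) $ i)"] by simp
  also have "\<dots> = norm2 (R *\<^sub>v x) * norm2 (R *\<^sub>v y)"
    by (simp add: L2_set_def norm2_sq_sum[OF Rx, symmetric] norm2_sq_sum[OF Ry, symmetric])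
  also have "\<dots> = weighted_norm H x * weighted_norm H y"
    by (simp add: weighted_norm_def norm2_def eq assms)
  finally show ?thesis .
qed

subsection \<open>Least squares\<close>

text \<open>Injectivity makes the Gram matrix positive definite, so the normal equations have a
  solution; its residual is orthogonal to the range of \<open>T\<close>, and Pythagoras gives
  minimality.\<close>

lemma least_squares_minimizer:
  assumes T: "T \<in> carrier_mat k n" and c: "c \<in> carrier_vec k"
    and inj: "\<And>x. x \<in> carrier_vec n \<Longrightarrow> T *\<^sub>v x = 0\<^sub>v k \<Longrightarrow> x = 0\<^sub>v n"
  obtains x where "x \<in> carrier_vec n"
    "\<And>y. y \<in> carrier_vec n \<Longrightarrow> norm2 (c - T *\<^sub>v x) \<le> norm2 (c - T *\<^sub>v y)"
proof -
  let ?T' = "mat_adjoint T"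
  have T': "?T' \<in> carrier_mat n k" using T by auto
  define G where "G = ?T' * T"
  have G: "hermitian_pd n G"
    using hermitian_pd_congruence[OF hermitian_pd_one T inj]
    unfolding G_def right_mult_one_mat[OF T'] .
  define x where "x = inv_mat G *\<^sub>v (?T' *\<^sub>v c)"
  have x: "x \<in> carrier_vec n"
    using hermitian_pd_inv_mat(1)[OF G] T' c by (auto simp: x_def)
  have "?T' *\<^sub>v (T *\<^sub>v x) = G *\<^sub>v x"
    using T x by (simp add: G_def mat_mult_vec_assoc)
  also have "\<dots> = ?T' *\<^sub>v c"
    unfolding x_def using T' c by (intro mult_inv_mat_vec[OF G]) auto
  finally have normal: "?T' *\<^sub>v (T *\<^sub>v x) = ?T' *\<^sub>v c" .
  define r where "r = c - T *\<^sub>v x"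
  have r: "r \<in> carrier_vec k" using T c x by (auto simp: r_def)
  have T'r: "?T' *\<^sub>v r = 0\<^sub>v n"
    unfolding r_def mult_minus_distrib_mat_vec[OF T' c mult_mat_vec_carrier[OF T x]] normal
    using mult_mat_vec_carrier[OF T' c] by simp
  have "norm2 r \<le> norm2 (c - T *\<^sub>v y)" if y: "y \<in> carrier_vec n" for y
  proof -
    let ?s = "T *\<^sub>v (x - y)"
    have s: "?s \<in> carrier_vec k" using T x y by auto
    have sr: "?s \<bullet>c r = 0"
      using cscalar_prod_adjoint[OF T _ r, of "x - y"] x y T'r by simp
    then have rs: "r \<bullet>c ?s = 0" using cscalar_prod_cnj[OF s r] by simp
    have Ts: "?s = T *\<^sub>v x - T *\<^sub>v y" by (rule mult_minus_distrib_mat_vec[OF T x y])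
    \<comment> \<open>The competing residual is the optimal one plus a vector in the range of
      \<open>T\<close>, and the two are orthogonal.\<close>
    have "c - T *\<^sub>v y = r + ?s"
      unfolding r_def Ts using T c by (intro eq_vecI) auto
    then have "(c - T *\<^sub>v y) \<bullet>c (c - T *\<^sub>v y) = r \<bullet>c r + ?s \<bullet>c ?s"
      using r s sr rs
      by (simp add: add_scalar_prod_distrib[of _ k] scalar_prod_add_distrib[of _ k] conjugate_add_vec[of _ k])
    moreover have "c - T *\<^sub>v y \<in> carrier_vec k" using T c y by auto
    ultimately have "(norm2 (c - T *\<^sub>v y))\<^sup>2 = (norm2 r)\<^sup>2 + (norm2 ?s)\<^sup>2"
      by (simp only: norm2_sq[OF r] norm2_sq[OF s] norm2_sq of_real_add[symmetric] of_real_eq_iff)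
    then have "(norm2 r)\<^sup>2 \<le> (norm2 (c - T *\<^sub>v y))\<^sup>2" by simp
    then show ?thesis by (rule power2_le_imp_le) simp
  qed
  then show ?thesis using that x unfolding r_def by blast
qed

subsection \<open>The flexible Lanczos process\<close>

lemma dim_cols_upto [simp]:
  "dim_row (cols_upto n l u) = n" "dim_col (cols_upto n l u) = l"
  by (simp_all add: cols_upto_def)

lemma cols_upto_carrier [simp]: "cols_upto n l u \<in> carrier_mat n l"
  by (rule carrier_matI) simp_all

lemma index_cols_upto:
  "i < n \<Longrightarrow> j < l \<Longrightarrow> cols_upto n l u $$ (i, j) = u (Suc j) $ i"
  by (simp add: cols_upto_def mat_of_cols_index del: upt_Suc)

lemma col_cols_upto:
  "j < l \<Longrightarrow> u (Suc j) \<in> carrier_vec n \<Longrightarrow> col (cols_upto n l u) j = u (Suc j)"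
  by (intro eq_vecI) (simp_all add: index_cols_upto)

lemma lanczos_T_carrier [simp]: "lanczos_T m \<alpha> \<beta> \<gamma> \<in> carrier_mat (m + 1) m"
  by (simp add: lanczos_T_def)

lemma dim_lanczos_T [simp]:
  "dim_row (lanczos_T m \<alpha> \<beta> \<gamma>) = m + 1" "dim_col (lanczos_T m \<alpha> \<beta> \<gamma>) = m"
  by (simp_all add: lanczos_T_def)

text \<open>Back substitution: row \<open>j + 1\<close> of \<open>T\<close> starts with the
  subdiagonal entry in column \<open>j\<close>. Once the later entries of \<open>x\<close> are known
  to vanish, only that nonzero entry times \<open>x $ j\<close> remains.\<close>

lemma lanczos_T_injective:
  assumes \<beta>: "\<And>k. k \<in> {1..m} \<Longrightarrow> \<beta> k \<noteq> 0"
    and x: "x \<in> carrier_vec m" and zero: "lanczos_T m \<alpha> \<beta> \<gamma> *\<^sub>v x = 0\<^sub>v (m + 1)"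
  shows "x = 0\<^sub>v m"
proof (rule eq_vecI)
  have "x $ j = 0" if "j < m" for j
    using that
  proof (induction "m - j" arbitrary: j rule: less_induct)
    case less
    have later: "x $ l = 0" if "j < l" "l < m" for l
      using less that by (meson diff_less_mono2)
    have "0 = (lanczos_T m \<alpha> \<beta> \<gamma> *\<^sub>v x) $ Suc j"
      using less.prems by (simp add: zero)
    also have "\<dots> = (\<Sum>l<m. lanczos_T m \<alpha> \<beta> \<gamma> $$ (Suc j, l) * x $ l)"
      using less.prems x by (simp add: scalar_prod_def lessThan_atLeast0)
    also have "\<dots> = (\<Sum>l<m. if l = j then \<beta> (Suc j) * x $ j else 0)"
      using less.prems by (intro sum.cong) (auto simp: lanczos_T_def later)
    finally have "\<beta> (Suc j) * x $ j = 0"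
      using less.prems by simp
    then show ?case using \<beta>[of "Suc j"] less.prems by simp
  qed
  then show "x $ j = 0\<^sub>v m $ j" if "j < dim_vec (0\<^sub>v m)" for j using that by simp
qed (use x in simp)

text \<open>\<open>arg_min_on\<close> is a choice operator and yields a minimizer only if one
  exists. The least squares lemma supplies it, and then the infimum \<open>fmr_rho\<close> is
  attained.\<close>

lemma fmr_coeffs_minimizer:
  assumes "\<And>k. k \<in> {1..m} \<Longrightarrow> \<beta> k \<noteq> 0"
  shows "fmr_coeffs m \<alpha> \<beta> \<gamma> \<in> carrier_vec m"
    "fmr_residual m \<alpha> \<beta> \<gamma> (fmr_coeffs m \<alpha> \<beta> \<gamma>) = fmr_rho m \<alpha> \<beta> \<gamma>"
proof -
  let ?f = "fmr_residual m \<alpha> \<beta> \<gamma>" and ?\<zeta> = "fmr_coeffs m \<alpha> \<beta> \<gamma>"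
  have "\<beta> 0 \<cdot>\<^sub>v unit_vec (m + 1) 0 \<in> carrier_vec (m + 1)" by simp
  then obtain x where x: "x \<in> carrier_vec m" "\<And>y. y \<in> carrier_vec m \<Longrightarrow> ?f x \<le> ?f y"
    unfolding fmr_residual_def
    by (rule least_squares_minimizer[OF lanczos_T_carrier _ lanczos_T_injective[OF assms]])
      blast+
  then have "is_arg_min ?f (\<lambda>\<zeta>. \<zeta> \<in> carrier_vec m) x"
    by (auto simp: is_arg_min_def not_less)
  then have "is_arg_min ?f (\<lambda>\<zeta>. \<zeta> \<in> carrier_vec m) ?\<zeta>"
    unfolding fmr_coeffs_def arg_min_on_def arg_min_def by (rule someI)
  then have \<zeta>: "?\<zeta> \<in> carrier_vec m" "\<And>y. y \<in> carrier_vec m \<Longrightarrow> ?f ?\<zeta> \<le> ?f y"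
    by (auto simp: is_arg_min_def not_less)
  then show "?\<zeta> \<in> carrier_vec m" by blast
  show "?f ?\<zeta> = fmr_rho m \<alpha> \<beta> \<gamma>"
    unfolding fmr_rho_def by (rule cInf_eq_minimum[symmetric]) (use \<zeta> in auto)
qed

text \<open>The matrix \<open>H\<close> does not occur here: the relations below hold for every
  choice of the vectors \<open>wh\<close> that avoids breakdown, however well or badly they
  approximate the exact solves.\<close>

locale lanczos =
  fixes n m :: nat and M :: "complex mat" and r0 :: "complex vec"
    and w wh v z :: "nat \<Rightarrow> complex vec" and \<alpha> \<beta> \<gamma> :: "nat \<Rightarrow> complex"
  assumes M: "M \<in> carrier_mat n n" and r0: "r0 \<in> carrier_vec n"
    and process: "flexible_lanczos n M r0 m w wh \<alpha> \<beta> \<gamma> v z"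
    and no_breakdown: "no_breakdown m w wh"
begin

lemma start: "w 0 = r0" "v 0 = 0\<^sub>v n" "z 0 = 0\<^sub>v n"
  using process by (auto simp: flexible_lanczos_def)

lemma wh_carrier: "k \<le> m \<Longrightarrow> wh k \<in> carrier_vec n"
  using process by (auto simp: flexible_lanczos_def)

lemma \<beta>_eq: "k \<le> m \<Longrightarrow> \<beta> k = csqrt (w k \<bullet>c wh k)"
  using process by (auto simp: flexible_lanczos_def)

lemma v_Suc: "k \<le> m \<Longrightarrow> v (Suc k) = (1 / \<beta> k) \<cdot>\<^sub>v w k"
  using process by (auto simp: flexible_lanczos_def)

lemma z_Suc: "k \<le> m \<Longrightarrow> z (Suc k) = (1 / \<beta> k) \<cdot>\<^sub>v wh k"
  using process by (auto simp: flexible_lanczos_def)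

lemma w_step:
  "Suc k \<le> m \<Longrightarrow>
    w (Suc k) = M *\<^sub>v z (Suc k) - \<alpha> (Suc k) \<cdot>\<^sub>v v (Suc k) - \<gamma> (Suc k) \<cdot>\<^sub>v v k"
  using process by (auto simp: flexible_lanczos_def)

text \<open>On a positive real, \<open>csqrt\<close> is the ordinary root, so conjugation leaves
  \<open>\<beta> k\<close> fixed.\<close>

lemma \<beta>_real:
  assumes "k \<le> m"
  obtains s where "0 < s" "\<beta> k = complex_of_real s" "w k \<bullet>c wh k = complex_of_real (s\<^sup>2)"
proof -
  obtain p where p: "w k \<bullet>c wh k = complex_of_real p" "0 < p"
    using no_breakdown assms by (auto simp: no_breakdown_def Reals_def)
  then have "\<beta> k = complex_of_real (sqrt p)"
    using \<beta>_eq[OF assms] csqrt_of_real_nonneg[of "complex_of_real p"] by simp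
  then show ?thesis using that[of "sqrt p"] p by simp
qed

lemma \<beta>_nonzero: "k \<le> m \<Longrightarrow> \<beta> k \<noteq> 0"
  by (metis \<beta>_real of_real_eq_0_iff less_irrefl)

lemma z_carrier: "k \<le> Suc m \<Longrightarrow> z k \<in> carrier_vec n"
  using start(3) z_Suc wh_carrier by (cases k) auto

text \<open>The two families depend on each other: \<open>v (k + 1)\<close> rescales
  \<open>w k\<close>, and \<open>w (k + 1)\<close> combines \<open>v (k + 1)\<close> and
  \<open>v k\<close>. Hence the joint induction; \<open>v\<close> reaches one index further than
  \<open>w\<close>.\<close>

lemma vw_carrier: "(k \<le> Suc m \<longrightarrow> v k \<in> carrier_vec n) \<and> (k \<le> m \<longrightarrow> w k \<in> carrier_vec n)"
proof (induction k)
  case 0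
  then show ?case using start r0 by simp
next
  case (Suc k)
  have v: "v (Suc k) \<in> carrier_vec n" if "k \<le> m"
    using Suc that by (simp add: v_Suc)
  moreover have "w (Suc k) \<in> carrier_vec n" if "Suc k \<le> m"
    unfolding w_step[OF that]
    using Suc v that M z_carrier[of "Suc k"] by auto
  ultimately show ?case by simp
qed

lemma v_carrier: "k \<le> Suc m \<Longrightarrow> v k \<in> carrier_vec n"
  and w_carrier: "k \<le> m \<Longrightarrow> w k \<in> carrier_vec n"
  using vw_carrier by blast+

lemma w_eq: "k \<le> m \<Longrightarrow> w k = \<beta> k \<cdot>\<^sub>v v (Suc k)"
  using \<beta>_nonzero[of k] by (simp add: v_Suc smult_smult_assoc)

text \<open>Both vectors carry the factor \<open>1 / \<beta> k\<close>, once conjugated, and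
  \<open>\<beta> k\<close> is the positive root of the inner product being divided.\<close>

lemma v_z_normalized:
  assumes "k \<le> m"
  shows "v (Suc k) \<bullet>c z (Suc k) = 1"
proof -
  obtain s where s: "0 < s" "\<beta> k = complex_of_real s" "w k \<bullet>c wh k = complex_of_real (s\<^sup>2)"
    by (rule \<beta>_real[OF assms])
  have "v (Suc k) \<bullet>c z (Suc k) = (1 / \<beta> k) * (cnj (1 / \<beta> k) * (w k \<bullet>c wh k))"
    unfolding v_Suc[OF assms] z_Suc[OF assms] conjugate_smult_vec
    using w_carrier[OF assms] wh_carrier[OF assms]
    by (simp add: smult_scalar_prod_distrib[of _ n] scalar_prod_smult_distrib[of _ n])
  also have "\<dots> = 1"
    unfolding s(2,3) using s(1) by (simp add: power2_eq_square)
  finally show ?thesis .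
qed

lemma M_z:
  assumes j: "j < m" and i: "i < n"
  shows "(M *\<^sub>v z (Suc j)) $ i =
    v (Suc j) $ i * \<alpha> (Suc j) + v (Suc (Suc j)) $ i * \<beta> (Suc j) + v j $ i * \<gamma> (Suc j)"
proof -
  have "v j \<in> carrier_vec n" "v (Suc j) \<in> carrier_vec n" "v (Suc (Suc j)) \<in> carrier_vec n"
    using j by (auto intro: v_carrier)
  note dims = this[THEN carrier_vecD] carrier_matD[OF M]
  have "w (Suc j) = \<beta> (Suc j) \<cdot>\<^sub>v v (Suc (Suc j))"
    using j by (intro w_eq) simp
  then have "(M *\<^sub>v z (Suc j) - \<alpha> (Suc j) \<cdot>\<^sub>v v (Suc j) - \<gamma> (Suc j) \<cdot>\<^sub>v v j) $ i
      = (\<beta> (Suc j) \<cdot>\<^sub>v v (Suc (Suc j))) $ i"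
    using w_step[of j] j by simp
  then show ?thesis
    using i by (simp add: dims algebra_simps del: index_mult_mat_vec)
qed

text \<open>Column \<open>j\<close> is the three-term recurrence of step \<open>j + 1\<close> solved
  for \<open>M *\<^sub>v z (Suc j)\<close>. Each term is written as a sum with one possibly nonzero
  summand, to be matched with the three diagonals of \<open>T\<close>.\<close>

lemma lanczos_relation:
  "M * cols_upto n m z = cols_upto n (m + 1) v * lanczos_T m \<alpha> \<beta> \<gamma>" (is "?L = ?R")
proof (rule eq_matI)
  fix i j assume "i < dim_row ?R" "j < dim_col ?R"
  then have i: "i < n" and j: "j < m" by auto
  let ?T = "lanczos_T m \<alpha> \<beta> \<gamma>"
  have "?L $$ (i, j) = (M *\<^sub>v z (Suc j)) $ i"
    using i j M z_carrier[of "Suc j"] by (simp add: col_cols_upto)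
  also have "\<dots> = v (Suc j) $ i * \<alpha> (Suc j) + v (Suc (Suc j)) $ i * \<beta> (Suc j) + v j $ i * \<gamma> (Suc j)"
    by (rule M_z[OF j i])
  \<comment> \<open>For \<open>j = 0\<close> there is no superdiagonal position and the sum is empty
    of matches; the term itself vanishes because \<open>v 0\<close> is zero.\<close>
  also have "v j $ i * \<gamma> (Suc j) = (\<Sum>k<m + 1. if Suc k = j then v j $ i * \<gamma> (Suc j) else 0)"
  proof (cases j)
    case 0
    then show ?thesis using i by (simp add: start)
  next
    case (Suc l)
    then show ?thesis using j by simp
  qed
  also have "v (Suc j) $ i * \<alpha> (Suc j) = (\<Sum>k<m + 1. if k = j then v (Suc j) $ i * \<alpha> (Suc j) else 0)"
    using j by simp
  also have "v (Suc (Suc j)) $ i * \<beta> (Suc j) =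
      (\<Sum>k<m + 1. if k = Suc j then v (Suc (Suc j)) $ i * \<beta> (Suc j) else 0)"
    using j by simp
  also have "(\<Sum>k<m + 1. if k = j then v (Suc j) $ i * \<alpha> (Suc j) else 0) +
      (\<Sum>k<m + 1. if k = Suc j then v (Suc (Suc j)) $ i * \<beta> (Suc j) else 0) +
      (\<Sum>k<m + 1. if Suc k = j then v j $ i * \<gamma> (Suc j) else 0) =
      (\<Sum>k<m + 1. v (Suc k) $ i * ?T $$ (k, j))"
    unfolding sum.distrib[symmetric] using j
    by (intro sum.cong) (auto simp: lanczos_T_def)
  also have "\<dots> = ?R $$ (i, j)"
    using i j by (simp add: scalar_prod_def lessThan_atLeast0 index_cols_upto del: sum.lessThan_Suc sum.op_ivl_Suc)
  finally show "?L $$ (i, j) = ?R $$ (i, j)" .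
qed (simp_all add: carrier_matD[OF M])

text \<open>The starting vector is \<open>\<beta> 0\<close> times the first basis vector, and the
  Lanczos relation moves the rest into the range of the same basis matrix.\<close>

lemma residual_relation:
  assumes \<zeta>: "\<zeta> \<in> carrier_vec m"
  shows "r0 - M *\<^sub>v (cols_upto n m z *\<^sub>v \<zeta>) =
    cols_upto n (m + 1) v *\<^sub>v (\<beta> 0 \<cdot>\<^sub>v unit_vec (m + 1) 0 - lanczos_T m \<alpha> \<beta> \<gamma> *\<^sub>v \<zeta>)"
proof -
  let ?V = "cols_upto n (m + 1) v" and ?T = "lanczos_T m \<alpha> \<beta> \<gamma>"
  have e: "\<beta> 0 \<cdot>\<^sub>v unit_vec (m + 1) 0 \<in> carrier_vec (m + 1)" by simp
  have "?V *\<^sub>v unit_vec (m + 1) 0 = col ?V 0"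
    by (rule eq_vecI) simp_all
  also have "\<dots> = v (Suc 0)"
    by (rule col_cols_upto) (simp_all add: v_carrier)
  finally have "?V *\<^sub>v (\<beta> 0 \<cdot>\<^sub>v unit_vec (m + 1) 0) = \<beta> 0 \<cdot>\<^sub>v v (Suc 0)"
    using mult_mat_vec[OF cols_upto_carrier unit_vec_carrier] by metis
  also have "\<dots> = r0" using w_eq[of 0] start(1) by simp
  finally have V0: "?V *\<^sub>v (\<beta> 0 \<cdot>\<^sub>v unit_vec (m + 1) 0) = r0" .
  have "?V *\<^sub>v (?T *\<^sub>v \<zeta>) = M *\<^sub>v (cols_upto n m z *\<^sub>v \<zeta>)"
    unfolding assoc_mult_mat_vec[OF M cols_upto_carrier \<zeta>, symmetric] lanczos_relation
    by (rule assoc_mult_mat_vec[OF cols_upto_carrier lanczos_T_carrier \<zeta>, symmetric])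
  then show ?thesis
    using V0 mult_minus_distrib_mat_vec[OF cols_upto_carrier e mult_mat_vec_carrier[OF lanczos_T_carrier \<zeta>]]
    by simp
qed

end

section \<open>Inexact solves and the final estimates\<close>

lemma inexact_solve_bound:
  assumes H: "hermitian_pd n H" and x: "x \<in> carrier_vec n" and y: "y \<in> carrier_vec n"
    and xy: "x \<bullet>c y = 1" and "\<epsilon> < 1"
    and approx: "weighted_norm H (y - inv_mat H *\<^sub>v x) \<le> \<epsilon> * weighted_norm H (inv_mat H *\<^sub>v x)"
  shows "(weighted_norm (inv_mat H) x)\<^sup>2 \<le> 1 / (1 - \<epsilon>)"
proof -
  define g where "g = inv_mat H *\<^sub>v x"
  define d where "d = y - g"
  define t where "t = weighted_norm H g"
  have g: "g \<in> carrier_vec n"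
    using mult_mat_vec_carrier[OF hermitian_pd_inv_mat(1)[OF H] x] by (simp add: g_def)
  have d: "d \<in> carrier_vec n" using y g by (simp add: d_def)
  have Hg: "H *\<^sub>v g = x" unfolding g_def by (rule mult_inv_mat_vec[OF H x])
  have t0: "0 \<le> t" using hermitian_pd_nonneg[OF H g] by (simp add: t_def weighted_norm_def)
  have "y = g + d" using y g by (intro eq_vecI) (auto simp: d_def)
  then have "x \<bullet>c y = x \<bullet>c g + x \<bullet>c d"
    using x g d by (simp add: conjugate_add_vec[of _ n] scalar_prod_add_distrib[of _ n])
  \<comment> \<open>The normalisation is split along \<open>y = g + d\<close>. Since
    \<open>H *\<^sub>v g = x\<close>, the first part is the squared norm of \<open>g\<close>, and
    the second is open to Cauchy-Schwarz in the inner product of \<open>H\<close>.\<close>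
  then have "1 = Re (x \<bullet>c g) + Re (x \<bullet>c d)" using xy by (metis one_complex.sel(1) plus_complex.sel(1))
  moreover have "Re (x \<bullet>c g) = t\<^sup>2"
    using weighted_norm_sq[OF H g] by (simp add: Hg t_def)
  moreover have "\<bar>Re (x \<bullet>c d)\<bar> \<le> t * (\<epsilon> * t)"
  proof -
    have "\<bar>Re (x \<bullet>c d)\<bar> \<le> t * weighted_norm H d"
      using weighted_Cauchy_Schwarz[OF H g d] by (simp add: Hg t_def)
    also have "\<dots> \<le> t * (\<epsilon> * t)"
      using approx t0 by (intro mult_left_mono) (simp_all add: d_def t_def g_def)
    finally show ?thesis .
  qed
  ultimately have "t\<^sup>2 * (1 - \<epsilon>) \<le> 1" by (simp add: algebra_simps power2_eq_square)
  then have "t\<^sup>2 \<le> 1 / (1 - \<epsilon>)" using \<open>\<epsilon> < 1\<close> by (simp add: pos_le_divide_eq)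
  then show ?thesis by (simp add: t_def g_def weighted_norm_inv_mat_vec[OF H x])
qed

theorem proposition4p4:
  fixes n m :: nat
    and H S A B M :: "complex mat"
    and \<sigma> :: real
    and b x0 r0 :: "complex vec"
    and w wh v z :: "nat \<Rightarrow> complex vec"
    and \<alpha> \<beta> \<gamma> :: "nat \<Rightarrow> complex"
  assumes "hermitian_pd n H"
    and "S \<in> carrier_mat n n" and "mat_adjoint S = - S"
    and "A = complex_of_real \<sigma> \<cdot>\<^sub>m H + S"
    and "B = \<i> \<cdot>\<^sub>m S"
    and "M = (\<i> * complex_of_real \<sigma>) \<cdot>\<^sub>m H + B"
    and "b \<in> carrier_vec n" and "x0 \<in> carrier_vec n"
    and "r0 = \<i> \<cdot>\<^sub>v b - M *\<^sub>v x0"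
    and "1 \<le> m"
    and "flexible_lanczos n M r0 m w wh \<alpha> \<beta> \<gamma> v z"
    and "no_breakdown m w wh"
  shows "weighted_norm (inv_mat H) (b - A *\<^sub>v fmr_iterate n x0 m \<alpha> \<beta> \<gamma> z)
           \<le> inv_weighted_mat_norm H (cols_upto n (m + 1) v) * fmr_rho m \<alpha> \<beta> \<gamma>
         \<and> (\<forall>\<epsilon>::real. 0 \<le> \<epsilon> \<and> \<epsilon> < 1 \<and>
              (\<forall>k \<in> {1..m + 1}.
                 weighted_norm H (z k - inv_mat H *\<^sub>v v k)
                   \<le> \<epsilon> * weighted_norm H (inv_mat H *\<^sub>v v k))
              \<longrightarrow> inv_weighted_mat_norm H (cols_upto n (m + 1) v)
                    \<le> sqrt (real (m + 1) / (1 - \<epsilon>)))"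
proof -
  note H = \<open>hermitian_pd n H\<close>
  note Hc = hermitian_pdD(1)[OF H]
  let ?V = "cols_upto n (m + 1) v" and ?R = "inv_sqrt_mat H"
  have R: "?R \<in> carrier_mat n n"
    using hermitian_pdD(1)[OF inv_sqrt_mat(1)[OF H]] .
  have A: "A \<in> carrier_mat n n" using Hc assms by simp
  \<comment> \<open>The process runs on the rotated system, \<open>M\<close> being
    \<open>\<i>\<close> times \<open>A\<close>; residuals therefore differ by the factor
    \<open>\<i>\<close> only.\<close>
  have MA: "M = \<i> \<cdot>\<^sub>m A"
    unfolding assms using Hc \<open>S \<in> carrier_mat n n\<close> by (intro eq_matI) (auto simp: algebra_simps)
  have M: "M \<in> carrier_mat n n" using A by (simp add: MA)
  have r0: "r0 \<in> carrier_vec n"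
    using M assms(7-9) by simp
  interpret lanczos n m M r0 w wh v z \<alpha> \<beta> \<gamma>
    using M r0 assms(11,12) by unfold_locales
  have RV: "?R * ?V \<in> carrier_mat n (m + 1)" by (rule mult_carrier_mat[OF R cols_upto_carrier])
  have "weighted_norm (inv_mat H) (b - A *\<^sub>v fmr_iterate n x0 m \<alpha> \<beta> \<gamma> z)
      \<le> inv_weighted_mat_norm H ?V * fmr_rho m \<alpha> \<beta> \<gamma>"
  proof -
    let ?\<zeta> = "fmr_coeffs m \<alpha> \<beta> \<gamma>"
    let ?y = "\<beta> 0 \<cdot>\<^sub>v unit_vec (m + 1) 0 - lanczos_T m \<alpha> \<beta> \<gamma> *\<^sub>v ?\<zeta>"
    note \<zeta> = fmr_coeffs_minimizer[OF \<beta>_nonzero]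
    have \<zeta>c: "?\<zeta> \<in> carrier_vec m" by (rule \<zeta>) simp
    have y: "?y \<in> carrier_vec (m + 1)"
      by (rule minus_carrier_vec[OF _ mult_mat_vec_carrier[OF lanczos_T_carrier \<zeta>c]]) simp
    let ?x = "fmr_iterate n x0 m \<alpha> \<beta> \<gamma> z"
    have Z: "cols_upto n m z *\<^sub>v ?\<zeta> \<in> carrier_vec n"
      by (rule mult_mat_vec_carrier[OF cols_upto_carrier \<zeta>c])
    have x: "?x \<in> carrier_vec n" using \<open>x0 \<in> carrier_vec n\<close> Z by (simp add: fmr_iterate_def)
    let ?r = "b - A *\<^sub>v ?x"
    have Ax: "A *\<^sub>v ?x \<in> carrier_vec n" by (rule mult_mat_vec_carrier[OF A x])
    have r: "?r \<in> carrier_vec n" using \<open>b \<in> carrier_vec n\<close> Ax by simp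
    have "\<i> \<cdot>\<^sub>v ?r = \<i> \<cdot>\<^sub>v b - M *\<^sub>v ?x"
      unfolding MA using A x \<open>b \<in> carrier_vec n\<close> by (intro eq_vecI) (auto simp: algebra_simps)
    also have "M *\<^sub>v ?x = M *\<^sub>v x0 + M *\<^sub>v (cols_upto n m z *\<^sub>v ?\<zeta>)"
      unfolding fmr_iterate_def by (rule mult_add_distrib_mat_vec[OF M \<open>x0 \<in> carrier_vec n\<close> Z])
    also have "\<i> \<cdot>\<^sub>v b - \<dots> = r0 - M *\<^sub>v (cols_upto n m z *\<^sub>v ?\<zeta>)"
      unfolding \<open>r0 = _\<close>
      using mult_mat_vec_carrier[OF M \<open>x0 \<in> carrier_vec n\<close>] mult_mat_vec_carrier[OF M Z] \<open>b \<in> carrier_vec n\<close>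
      by (intro eq_vecI) (simp_all add: carrier_vecD del: index_mult_mat_vec)
    also have "\<dots> = ?V *\<^sub>v ?y" by (rule residual_relation[OF \<zeta>c])
    finally have ir: "\<i> \<cdot>\<^sub>v ?r = ?V *\<^sub>v ?y" .
    \<comment> \<open>The factor \<open>\<i>\<close> has modulus 1, so it can be inserted without
      changing the norm, which brings in the rotated residual.\<close>
    have "weighted_norm (inv_mat H) ?r = norm2 (\<i> \<cdot>\<^sub>v (?R *\<^sub>v ?r))"
      using weighted_norm_inv_mat[OF H r] norm2_smult[OF mult_mat_vec_carrier[OF R r], of \<i>] by simp
    also have "\<i> \<cdot>\<^sub>v (?R *\<^sub>v ?r) = ?R *\<^sub>v (\<i> \<cdot>\<^sub>v ?r)"
      by (rule mult_mat_vec[OF R r, symmetric])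
    also have "\<dots> = ?R * ?V *\<^sub>v ?y"
      unfolding ir by (rule assoc_mult_mat_vec[OF R cols_upto_carrier y, symmetric])
    also have "norm2 \<dots> \<le> spectral_norm (?R * ?V) * norm2 ?y"
      by (rule spectral_norm_bound[OF RV y])
    also have "norm2 ?y = fmr_rho m \<alpha> \<beta> \<gamma>"
      unfolding fmr_residual_def[symmetric] by (rule \<zeta>) simp
    finally show ?thesis by (simp add: inv_weighted_mat_norm_def)
  qed
  moreover have "inv_weighted_mat_norm H ?V \<le> sqrt (real (m + 1) / (1 - \<epsilon>))"
    if \<epsilon>: "\<epsilon> < 1" and approx: "\<And>k. k \<in> {1..m + 1} \<Longrightarrow>
      weighted_norm H (z k - inv_mat H *\<^sub>v v k) \<le> \<epsilon> * weighted_norm H (inv_mat H *\<^sub>v v k)" for \<epsilon> :: real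
  proof -
    have "(norm2 (col (?R * ?V) j))\<^sup>2 \<le> 1 / (1 - \<epsilon>)" if j: "j < m + 1" for j
    proof -
      have v: "v (Suc j) \<in> carrier_vec n" and z: "z (Suc j) \<in> carrier_vec n"
        using j by (auto intro: v_carrier z_carrier)
      have "col (?R * ?V) j = ?R *\<^sub>v v (Suc j)"
        using col_mult2[OF R cols_upto_carrier j] col_cols_upto[of j "m + 1" v, OF j v] by simp
      then have "(norm2 (col (?R * ?V) j))\<^sup>2 = (weighted_norm (inv_mat H) (v (Suc j)))\<^sup>2"
        by (simp add: weighted_norm_inv_mat[OF H v])
      also have "\<dots> \<le> 1 / (1 - \<epsilon>)"
        using j by (intro inexact_solve_bound[OF H v z v_z_normalized \<epsilon> approx]) simp_all
      finally show ?thesis .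
    qed
    \<comment> \<open>All \<open>m + 1\<close> columns obey the same bound, which produces the
      factor \<open>m + 1\<close> under the root of the Frobenius norm.\<close>
    then have "(\<Sum>j<m + 1. (norm2 (col (?R * ?V) j))\<^sup>2) \<le> (\<Sum>j<m + 1. 1 / (1 - \<epsilon>))"
      by (intro sum_mono) simp
    then have "sqrt (\<Sum>j<m + 1. (norm2 (col (?R * ?V) j))\<^sup>2) \<le> sqrt (real (m + 1) / (1 - \<epsilon>))"
      by (simp del: sum.lessThan_Suc)
    then show ?thesis
      using spectral_norm_le[OF RV] unfolding inv_weighted_mat_norm_def by linarith
  qed
  ultimately show ?thesis by blast
qed

end
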